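(* For any integers $m>0$ and $n>1$, there exist infinitely many (pairwise non-isomorphic) connected quandles $X$ that satisfy the identity $xw=x$ for $$w=\underbrace{y_1*\cdots*y_m*y_1*\cdots*y_m*\cdots*y_1*\cdots*y_m}_{n\ \text{repetitions of } y_1*\cdots*y_m},$$ that is, such that for all $x,y_1,\dots,y_m\in X$ the left-associated product of $x$ followed by the sequence $y_1,\dots,y_m$ repeated $n$ times equals $x$.
   Context: A quandle is a non-empty set $X$ with a binary operation $*$ such that (1) for every $b\in X$ the map $R_b:X\to X$, $R_b(a)=a*b$, is a bijection, (2) $(a*b)*c=(a*c)*(b*c)$ for all $a,b,c\in X$, and (3) $a*a=a$ for all $a\in X$. Products are left-associated: $x*y_1*y_2*\cdots*y_k=(\cdots((x*y_1)*y_2)\cdots)*y_k$; in $xw$ the letters of $w$ are applied one after another to $x$ in this way (and $w$ is not itself parenthesized). The inner automorphism group $\mathrm{Inn}(X)$ is the subgroup of $\mathrm{Sym}(X)$ generated by all $R_a$, $a\in X$; $X$ is connected if $\mathrm{Inn}(X)$ acts transitively on $X$. *)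

theory Defs
  imports "HOL-Algebra.Group_Action" "HOL-Algebra.Elementary_Groups"
begin

record 'a quandle_struct = "'a partial_object" +
  qop :: "'a \<Rightarrow> 'a \<Rightarrow> 'a" (infixl "\<triangleright>\<index>" 70)

text \<open>The operation is restricted to the carrier because \<^const>\<open>Bij\<close>, the underlying set
  of the symmetric group \<^const>\<open>BijGroup\<close>, consists of extensional functions.\<close>

definition right_mult :: "('a, 'b) quandle_struct_scheme \<Rightarrow> 'a \<Rightarrow> 'a \<Rightarrow> 'a" where
  "right_mult X b = (\<lambda>a\<in>carrier X. a \<triangleright>\<^bsub>X\<^esub> b)"

text \<open>Closure of the carrier under the operation is part of the bijectivity axiom.\<close>

locale quandle =
  fixes X :: "('a, 'b) quandle_struct_scheme" (structure)
  assumes nonempty: "carrier X \<noteq> {}"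
    and right_mult_bij:
      "b \<in> carrier X \<Longrightarrow> bij_betw (right_mult X b) (carrier X) (carrier X)"
    and self_distrib:
      "\<lbrakk>a \<in> carrier X; b \<in> carrier X; c \<in> carrier X\<rbrakk>
        \<Longrightarrow> (a \<triangleright> b) \<triangleright> c = (a \<triangleright> c) \<triangleright> (b \<triangleright> c)"
    and idem: "a \<in> carrier X \<Longrightarrow> a \<triangleright> a = a"

definition Inn :: "('a, 'b) quandle_struct_scheme \<Rightarrow> ('a \<Rightarrow> 'a) monoid" where
  "Inn X = subgroup_generated (BijGroup (carrier X)) (right_mult X ` carrier X)"

locale connected_quandle = quandle +
  assumes transitive: "transitive_action (Inn X) (carrier X) (\<lambda>f. f)"

definition quandle_iso ::
    "('a, 'c) quandle_struct_scheme \<Rightarrow> ('b, 'd) quandle_struct_scheme \<Rightarrow> ('a \<Rightarrow> 'b) set" where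
  "quandle_iso X Y = {f. bij_betw f (carrier X) (carrier Y) \<and>
     (\<forall>a\<in>carrier X. \<forall>b\<in>carrier X. f (a \<triangleright>\<^bsub>X\<^esub> b) = f a \<triangleright>\<^bsub>Y\<^esub> f b)}"

definition quandle_isomorphic ::
    "('a, 'c) quandle_struct_scheme \<Rightarrow> ('b, 'd) quandle_struct_scheme \<Rightarrow> bool" where
  "quandle_isomorphic X Y \<longleftrightarrow> quandle_iso X Y \<noteq> {}"

text \<open>The left-associated product of \<open>x\<close> followed by the letters of the list \<open>w\<close>.\<close>

definition left_prod :: "('a, 'b) quandle_struct_scheme \<Rightarrow> 'a \<Rightarrow> 'a list \<Rightarrow> 'a" where
  "left_prod X x w = foldl (qop X) x w"

end

theory Submission
  imports Defs "HOL-Number_Theory.Cong"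
begin

text \<open>Let \<open>q = 1 + a\<^sup>m + \<dots> + a\<^bsup>m(n-1)\<^esup>\<close> and let \<open>X\<close> be the integers modulo \<open>q\<close> with
  \<open>x * y = a x + (1 - a) y\<close>. Right multiplication by \<open>m\<close> successive letters is an affine map
  \<open>x \<mapsto> a\<^sup>m x + c\<close>, whose \<open>n\<close>-th iterate is \<open>x \<mapsto> a\<^bsup>mn\<^esup> x + q c\<close>, that is, the identity, since
  \<open>a\<^bsup>mn\<^esup> - 1 = (a\<^sup>m - 1) q\<close>. As \<open>q \<equiv> 1\<close> modulo \<open>a\<close>, the multiplier \<open>a\<close> is a unit. As \<open>q \<equiv> n\<close>
  modulo \<open>a - 1\<close>, the multiplier \<open>1 - a\<close> is a unit when \<open>a \<equiv> 2\<close> modulo \<open>n\<close>, and then any point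
  can be moved to any other by a single right multiplication. Different \<open>a\<close> give quandles of
  different cardinality.\<close>

section \<open>Affine quandles on residues modulo \<open>q\<close>\<close>

lemma bij_betw_affine_mod:
  fixes a c q :: nat
  assumes "coprime a q" and "q > 0"
  shows "bij_betw (\<lambda>x. (a * x + c) mod q) {..<q} {..<q}"
proof -
  have "inj_on (\<lambda>x. (a * x + c) mod q) {..<q}"
  proof (rule inj_onI)
    fix x y assume xy: "x \<in> {..<q}" "y \<in> {..<q}"
      and "(a * x + c) mod q = (a * y + c) mod q"
    then have "[a * x + c = a * y + c] (mod q)"
      by (simp add: cong_def)
    then have "[x = y] (mod q)"
      using assms by (simp add: cong_add_rcancel_nat cong_mult_lcancel_nat)
    with xy show "x = y"
      by (simp add: cong_less_modulus_unique_nat)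
  qed
  moreover have "(\<lambda>x. (a * x + c) mod q) ` {..<q} \<subseteq> {..<q}"
    using assms by auto
  ultimately show ?thesis
    by (simp add: bij_betw_def endo_inj_surj)
qed

text \<open>These are Alexander quandles on a cyclic group. The separate parameter \<open>b\<close>
  stands for 1 - a, which avoids subtraction of naturals; lemmas assume
  \<open>[a + b = 1] (mod q)\<close> where it matters.\<close>

definition affine_quandle :: "nat \<Rightarrow> nat \<Rightarrow> nat \<Rightarrow> nat quandle_struct" where
  "affine_quandle a b q = \<lparr>carrier = {..<q}, qop = \<lambda>x y. (a * x + b * y) mod q\<rparr>"

lemma carrier_affine_quandle [simp]: "carrier (affine_quandle a b q) = {..<q}"
  and qop_affine_quandle [simp]: "qop (affine_quandle a b q) x y = (a * x + b * y) mod q"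
  by (simp_all add: affine_quandle_def)

lemma quandle_affine_quandle:
  assumes "q > 0" and "coprime a q" and ab: "[a + b = 1] (mod q)"
  shows "quandle (affine_quandle a b q)"
proof
  show "carrier (affine_quandle a b q) \<noteq> {}"
    using assms by auto
next
  fix y assume "y \<in> carrier (affine_quandle a b q)"
  show "bij_betw (right_mult (affine_quandle a b q) y)
      (carrier (affine_quandle a b q)) (carrier (affine_quandle a b q))"
    using bij_betw_affine_mod[OF assms(2,1), of "b * y"]
    by (simp add: right_mult_def bij_betw_restrict_eq)
next
  fix x y z :: nat
  have "[a * ((a * x + b * y) mod q) + b * z = a * (a * x + b * y) + b * z] (mod q)"
    by (intro cong_add cong_mult) simp_all
  \<comment> \<open>The factor 1 is inserted in order to be replaced by \<open>a + b\<close>, which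
    splits \<open>b * z\<close> into the two shares that the right-hand side needs.\<close>
  also have "a * (a * x + b * y) + b * z = a * (a * x + b * y) + b * z * 1"
    by simp
  also have "[a * (a * x + b * y) + b * z * 1 = a * (a * x + b * y) + b * z * (a + b)] (mod q)"
    using ab by (intro cong_add cong_mult cong_refl) (rule cong_sym)
  also have "a * (a * x + b * y) + b * z * (a + b) = a * (a * x + b * z) + b * (a * y + b * z)"
    by (simp add: algebra_simps)
  also have "[\<dots> = a * ((a * x + b * z) mod q) + b * ((a * y + b * z) mod q)] (mod q)"
    by (intro cong_add cong_mult) simp_all
  finally show "qop (affine_quandle a b q) (qop (affine_quandle a b q) x y) z =
      qop (affine_quandle a b q) (qop (affine_quandle a b q) x z) (qop (affine_quandle a b q) y z)"
    by (simp add: cong_def)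
next
  fix x assume x: "x \<in> carrier (affine_quandle a b q)"
  have "[(a + b) * x = 1 * x] (mod q)"
    using ab by (intro cong_mult cong_refl)
  with x show "qop (affine_quandle a b q) x x = x"
    by (simp add: cong_def algebra_simps)
qed

section \<open>Inner automorphisms and connectedness\<close>

lemma (in quandle) right_mult_in_Bij:
  assumes "b \<in> carrier X"
  shows "right_mult X b \<in> Bij (carrier X)"
  using right_mult_bij[OF assms] by (simp add: Bij_def right_mult_def)

lemma (in quandle) right_mult_in_Inn:
  assumes "b \<in> carrier X"
  shows "right_mult X b \<in> carrier (Inn X)"
  unfolding Inn_def carrier_subgroup_generated
  using assms right_mult_in_Bij by (auto simp: BijGroup_def intro: generate.incl)

lemma (in quandle) Inn_action: "group_action (Inn X) (carrier X) (\<lambda>f. f)"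
proof -
  interpret B: group "BijGroup (carrier X)"
    by (rule group_BijGroup)
  have "group (Inn X)"
    unfolding Inn_def by (rule B.group_subgroup_generated)
  moreover have "(\<lambda>f. f) \<in> hom (Inn X) (BijGroup (carrier X))"
    using B.carrier_subgroup_generated_subset by (auto simp: hom_def Inn_def)
  ultimately show ?thesis
    by (simp add: group_action_def group_hom_def group_hom_axioms_def B.is_group)
qed

lemma (in quandle) connected_quandleI:
  assumes "\<And>x y. \<lbrakk>x \<in> carrier X; y \<in> carrier X\<rbrakk> \<Longrightarrow> \<exists>z\<in>carrier X. x \<triangleright> z = y"
  shows "connected_quandle X"
proof -
  interpret group_action "Inn X" "carrier X" "\<lambda>f. f"
    by (rule Inn_action)
  have "\<exists>f\<in>carrier (Inn X). f x = y" if xy: "x \<in> carrier X" "y \<in> carrier X" for x y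
  proof -
    obtain z where "z \<in> carrier X" "x \<triangleright> z = y"
      using assms xy by blast
    with xy show ?thesis
      by (intro bexI[of _ "right_mult X z"]) (simp_all add: right_mult_in_Inn, simp add: right_mult_def)
  qed
  then show ?thesis
    by unfold_locales blast
qed

text \<open>For fixed \<open>x\<close> the product is affine in its right argument with unit
  multiplier \<open>b\<close>, so some \<open>z\<close> sends \<open>x\<close> to any prescribed
  \<open>y\<close>.\<close>

lemma connected_affine_quandle:
  assumes "q > 0" and "coprime a q" and "coprime b q" and "[a + b = 1] (mod q)"
  shows "connected_quandle (affine_quandle a b q)"
proof -
  interpret quandle "affine_quandle a b q"
    by (rule quandle_affine_quandle) fact+
  show ?thesis
  proof (rule connected_quandleI)
    fix x y assume "x \<in> carrier (affine_quandle a b q)" "y \<in> carrier (affine_quandle a b q)"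
    then have "y \<in> (\<lambda>z. (b * z + a * x) mod q) ` {..<q}"
      using bij_betw_imp_surj_on[OF bij_betw_affine_mod[OF assms(3,1), of "a * x"]] by simp
    then show "\<exists>z\<in>carrier (affine_quandle a b q). qop (affine_quandle a b q) x z = y"
      by (auto simp: add.commute)
  qed
qed

section \<open>Repeated words in affine quandles\<close>

lemma left_prod_append: "left_prod X x (u @ v) = left_prod X (left_prod X x u) v"
  by (simp add: left_prod_def)

lemma left_prod_affine_quandle_less:
  assumes "x < q"
  shows "left_prod (affine_quandle a b q) x w < q"
  using assms by (induction w rule: rev_induct) (simp_all add: left_prod_def)

text \<open>The constant \<open>c\<close> depends on the letters of \<open>w\<close> but not on
  \<open>x\<close>, so each repetition of \<open>w\<close> iterates one and the same affine
  map.\<close>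

lemma left_prod_affine_quandle:
  obtains c where "\<And>x. [left_prod (affine_quandle a b q) x w = a ^ length w * x + c] (mod q)"
proof -
  have "\<exists>c. \<forall>x. [left_prod (affine_quandle a b q) x w = a ^ length w * x + c] (mod q)"
  proof (induction w rule: rev_induct)
    case Nil
    show ?case by (auto simp: left_prod_def intro!: exI[of _ 0])
  next
    case (snoc y w)
    then obtain c
      where c: "\<And>x. [left_prod (affine_quandle a b q) x w = a ^ length w * x + c] (mod q)"
      by blast
    have "[left_prod (affine_quandle a b q) x (w @ [y]) =
        a ^ length (w @ [y]) * x + (a * c + b * y)] (mod q)" for x
    proof -
      have "[a * left_prod (affine_quandle a b q) x w + b * y =
          a * (a ^ length w * x + c) + b * y] (mod q)"
        by (intro cong_add cong_mult cong_refl c)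
      then show ?thesis
        by (simp add: left_prod_def cong_def algebra_simps)
    qed
    then show ?case by blast
  qed
  with that show ?thesis by blast
qed

lemma left_prod_affine_quandle_power:
  assumes c: "\<And>x. [left_prod (affine_quandle a b q) x w = s * x + c] (mod q)"
  shows "[left_prod (affine_quandle a b q) x (concat (replicate n w)) =
    s ^ n * x + (\<Sum>i<n. s ^ i) * c] (mod q)"
proof (induction n arbitrary: x)
  case 0
  show ?case by (simp add: left_prod_def)
next
  case (Suc n)
  \<comment> \<open>The first copy of \<open>w\<close> is split off; the induction hypothesis
    applies to the point it leads to.\<close>
  let ?y = "left_prod (affine_quandle a b q) x w"
  have "[left_prod (affine_quandle a b q) ?y (concat (replicate n w)) =
      s ^ n * ?y + (\<Sum>i<n. s ^ i) * c] (mod q)"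
    by (rule Suc.IH)
  also have "[s ^ n * ?y + (\<Sum>i<n. s ^ i) * c =
      s ^ n * (s * x + c) + (\<Sum>i<n. s ^ i) * c] (mod q)"
    by (intro cong_add cong_mult cong_refl c)
  also have "s ^ n * (s * x + c) + (\<Sum>i<n. s ^ i) * c = s ^ Suc n * x + (\<Sum>i<Suc n. s ^ i) * c"
    by (simp add: algebra_simps)
  finally show ?case
    by (simp add: left_prod_append)
qed

section \<open>Geometric sums as moduli\<close>

lemma power_cong_1_mod_geometric_sum:
  fixes s :: nat
  shows "[s ^ n = 1] (mod (\<Sum>i<n. s ^ i))"
proof -
  \<comment> \<open>Both sides equal the sum of the powers of \<open>s\<close> from 0 to
    \<open>n\<close>.\<close>
  have "s ^ n + (\<Sum>i<n. s ^ i) = 1 + s * (\<Sum>i<n. s ^ i)"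
    by (induction n) (simp_all add: distrib_left)
  then show ?thesis
    unfolding cong_def by (metis mod_add_self2 mod_mult_self3 add.commute)
qed

lemma left_prod_affine_quandle_geometric_sum:
  assumes q: "q = (\<Sum>i<n. (a ^ length w) ^ i)" and x: "x < q"
  shows "left_prod (affine_quandle a b q) x (concat (replicate n w)) = x"
proof -
  obtain c where "\<And>x. [left_prod (affine_quandle a b q) x w = a ^ length w * x + c] (mod q)"
    using left_prod_affine_quandle by blast
  then have "[left_prod (affine_quandle a b q) x (concat (replicate n w)) =
      (a ^ length w) ^ n * x + q * c] (mod q)"
    unfolding q by (rule left_prod_affine_quandle_power)
  also have "[(a ^ length w) ^ n * x + q * c = 1 * x + 0] (mod q)"
    using power_cong_1_mod_geometric_sum[of "a ^ length w" n]
    by (intro cong_add cong_mult cong_refl) (simp_all add: q cong_mult_self_left)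
  finally show ?thesis
    using x left_prod_affine_quandle_less[OF x] cong_less_modulus_unique_nat by simp
qed

lemma geometric_sum_cong:
  fixes s d :: nat
  assumes "[s = 1] (mod d)"
  shows "[(\<Sum>i<n. s ^ i) = n] (mod d)"
proof -
  have "[(\<Sum>i<n. s ^ i) = (\<Sum>i<n. 1 ^ i)] (mod d)"
    by (intro cong_sum cong_pow assms)
  then show ?thesis by simp
qed

theorem proposition5p6:
  fixes m n :: nat
  assumes "m > 0" and "n > 1"
  shows "\<exists>\<Q> :: nat quandle_struct set.
    infinite \<Q> \<and>
    pairwise (\<lambda>X Y. \<not> quandle_isomorphic X Y) \<Q> \<and>
    (\<forall>X\<in>\<Q>. connected_quandle X \<and>
      (\<forall>x\<in>carrier X. \<forall>ys. set ys \<subseteq> carrier X \<and> length ys = m \<longrightarrow>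
        left_prod X x (concat (replicate n ys)) = x))"
proof -
  \<comment> \<open>\<open>d k\<close> is a - 1. Being 1 modulo \<open>n\<close>, it is coprime to
    \<open>n\<close>.\<close>
  define d where "d k = k * n + 1" for k
  define a where "a k = d k + 1" for k
  define q where "q k = (\<Sum>i<n. (a k ^ m) ^ i)" for k
  \<comment> \<open>This represents 1 - a modulo \<open>q k\<close>; the subtraction is not
    truncated, since \<open>d k < a k \<le> q k\<close> by \<open>a_le_q\<close>.\<close>
  define b where "b k = q k - d k" for k
  define X where "X k = affine_quandle (a k) (b k) (q k)" for k
  have q_Suc: "q k = 1 + a k ^ m * (\<Sum>i<n-1. (a k ^ m) ^ i)" for k
    using \<open>n > 1\<close> unfolding q_def
    by (cases n) (simp_all add: sum.lessThan_Suc_shift sum_distrib_left del: sum.lessThan_Suc)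
  have a_le_q: "a k \<le> q k" for k
  proof -
    have "a k \<le> a k ^ m"
      using \<open>m > 0\<close> by (intro self_le_power) (simp_all add: a_def)
    also have "\<dots> = (\<Sum>i\<in>{1}. (a k ^ m) ^ i)"
      by simp
    also have "\<dots> \<le> q k"
      unfolding q_def using \<open>n > 1\<close> by (intro sum_mono2) auto
    finally show ?thesis .
  qed
  have strict: "strict_mono q"
    unfolding q_def
  proof (rule strict_monoI)
    fix j k :: nat assume "j < k"
    then have "a j < a k"
      using \<open>n > 1\<close> by (simp add: a_def d_def)
    then have "a j ^ m < a k ^ m"
      using \<open>m > 0\<close> by (simp add: power_strict_mono)
    \<comment> \<open>The summands for \<open>i = 0\<close> agree; strictness comes from
      \<open>i = 1\<close>, which occurs because \<open>n > 1\<close>.\<close>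
    then show "(\<Sum>i<n. (a j ^ m) ^ i) < (\<Sum>i<n. (a k ^ m) ^ i)"
      using \<open>n > 1\<close>
      by (intro sum_strict_mono_ex1) (auto intro: power_mono bexI[of _ 1])
  qed
  have connected: "connected_quandle (X k)" for k
    unfolding X_def
  proof (rule connected_affine_quandle)
    show "q k > 0"
      by (simp add: q_Suc)
    have "coprime (a k ^ m) (q k)"
      unfolding q_Suc by (metis gcd_add_mult mult.commute add.commute coprime_1_right coprime_iff_gcd_eq_1)
    then show "coprime (a k) (q k)"
      using \<open>m > 0\<close> by simp
    have "[a k = 1] (mod d k)"
      by (simp add: a_def cong_add_rcancel_0_nat cong_0_iff del: add_Suc_right)
    then have "[a k ^ m = 1] (mod d k)"
      using cong_pow[of "a k" 1 "d k" m] by simp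
    then have "[q k = n] (mod d k)"
      unfolding q_def by (rule geometric_sum_cong)
    moreover have "coprime n (d k)"
      unfolding d_def by (metis gcd_add_mult coprime_1_right coprime_iff_gcd_eq_1)
    ultimately have "coprime (q k) (d k)"
      using cong_imp_coprime cong_sym by blast
    \<comment> \<open>Since \<open>b k\<close> and \<open>d k\<close> add up to \<open>q k\<close>,
      coprimality to \<open>q k\<close> passes from \<open>d k\<close> to
      \<open>b k\<close>.\<close>
    moreover have bq: "b k + d k = q k"
      using a_le_q[of k] by (simp add: b_def a_def)
    ultimately show "coprime (b k) (q k)"
      by (metis coprime_commute gcd_add2 coprime_iff_gcd_eq_1 add.commute)
    have "a k + b k = q k + 1"
      using bq by (simp add: a_def)
    then show "[a k + b k = 1] (mod q k)"
      by (simp add: cong_add_rcancel_0_nat cong_0_iff del: add_Suc_right)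
  qed
  have "\<not> quandle_isomorphic (X j) (X k)" if "X j \<noteq> X k" for j k
  proof
    assume "quandle_isomorphic (X j) (X k)"
    \<comment> \<open>An isomorphism preserves the cardinality of the carrier, which is
      \<open>q\<close>.\<close>
    then have "q j = q k"
      by (auto simp: quandle_isomorphic_def quandle_iso_def X_def dest: bij_betw_same_card)
    then have "j = k"
      by (simp add: strict_mono_eq[OF strict])
    with that show False
      by simp
  qed
  then have "pairwise (\<lambda>X Y. \<not> quandle_isomorphic X Y) (range X)"
    unfolding pairwise_def by blast
  moreover have "inj X"
  proof (rule injI)
    fix j k assume "X j = X k"
    then have "carrier (X j) = carrier (X k)"
      by simp
    then show "j = k"
      by (simp add: X_def strict_mono_eq[OF strict])
  qed
  then have "infinite (range X)"
    by (rule range_inj_infinite)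
  moreover have "left_prod (X k) x (concat (replicate n ys)) = x"
    if "x \<in> carrier (X k)" "length ys = m" for k x ys
    using that by (simp add: X_def q_def left_prod_affine_quandle_geometric_sum)
  ultimately show ?thesis
    using connected by (intro exI[of _ "range X"]) blast
qed

end
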